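(* Let $X,Y$ be Fréchet spaces, let $\tilde X$ be a closed linear subspace of $X$, and for every $j\in\{1,\dots,N\}$ and $k\in\mathbb N$ let $\mathcal A_{j,k}:D(\mathcal A_{j,k})\subseteq X\to Y$ be a multivalued linear operator. For every $k\in\mathbb N$ define the multivalued linear operator ${\mathbb A}_k:D({\mathbb A}_k)\subseteq X\to Y^N$ by $D({\mathbb A}_k):=\bigcap_{1\le j\le N}D(\mathcal A_{j,k})$ and ${\mathbb A}_kx:=\{(x_{1,k},\dots,x_{N,k}):x_{j,k}\in\mathcal A_{j,k}x\text{ for all }1\le j\le N\}$. Then the sequence $((\mathcal A_{j,k})_{k\in\mathbb N})_{1\le j\le N}$ is disjoint $(\tilde X,9)$-distributionally chaotic if and only if the sequence $({\mathbb A}_k)_{k\in\mathbb N}$ is $\tilde X$-distributionally chaotic.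
   Context: $X,Y$ are non-trivial Fréchet spaces over the same field $\mathbb K\in\{\mathbb R,\mathbb C\}$; the topology of $Y$ is induced by an increasing fundamental system of seminorms $(p_n^Y)_{n\in\mathbb N}$ and $d_Y(x,y)=\sum_{n\ge1}2^{-n}\frac{p_n^Y(x-y)}{1+p_n^Y(x-y)}$; if $Y$ is a Banach space, $d_Y(x,y)=\|x-y\|_Y$ instead. $N\ge2$. On $Y^N$ the metric used is $d_{Y^N}(\vec x,\vec y)=\max_{1\le j\le N}d_Y(x_j,y_j)$ (which induces the product topology). For $D\subseteq\mathbb N$, $\overline{dens}(D)=\limsup_{n\to\infty}\frac{card(D\cap[1,n])}{n}$. A multivalued linear operator (MLO) $\mathcal A:D(\mathcal A)\subseteq X\to Z$ ($Z$ a Fréchet space) is a map $\mathcal A:X\to P(Z)$ such that $D(\mathcal A)=\{x:\mathcal Ax\ne\emptyset\}$ is a linear subspace, $\mathcal Ax+\mathcal Ay\subseteq\mathcal A(x+y)$ and $\lambda\mathcal Ax\subseteq\mathcal A(\lambda x)$ for $x,y\in D(\mathcal A)$, $\lambda\in\mathbb K$. A sequence $(\mathcal B_k)_{k\in\mathbb N}$ of MLOs $\mathcal B_k:D(\mathcal B_k)\subseteq X\to Z$ is $\tilde X$-distributionally chaotic iff there exist an uncountable set $S\subseteq\bigcap_{k=1}^\infty D(\mathcal B_k)\cap\tilde X$ and $\sigma>0$ such that for each $\epsilon>0$ and each pair $x,y\in S$ of distinct points there exist, for each $k\in\mathbb N$, elements $x_k\in\mathcal B_kx$ and $y_k\in\mathcal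 B_ky$ with $\overline{dens}(\{k:d_Z(x_k,y_k)\ge\sigma\})=1$ and $\overline{dens}(\{k:d_Z(x_k,y_k)<\epsilon\})=1$. The sequence $((\mathcal A_{j,k})_{k\in\mathbb N})_{1\le j\le N}$ is disjoint $(\tilde X,9)$-distributionally chaotic iff there exist an uncountable set $S\subseteq\bigcap_{j=1}^N\bigcap_{k=1}^\infty D(\mathcal A_{j,k})\cap\tilde X$ and $\sigma>0$ such that for each $\epsilon>0$ and each pair $x,y\in S$ of distinct points there exist $x_{j,k}\in\mathcal A_{j,k}x$ and $y_{j,k}\in\mathcal A_{j,k}y$ ($1\le j\le N$, $k\in\mathbb N$) with $\overline{dens}\big(\bigcup_{1\le j\le N}\{k:d_Y(x_{j,k},y_{j,k})\ge\sigma\}\big)=1$ and $\overline{dens}\big(\bigcap_{1\le j\le N}\{k:d_Y(x_{j,k},y_{j,k})<\epsilon\}\big)=1$. *)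

theory Defs
  imports "HOL-Analysis.Analysis"
begin

text \<open>The scalar field is the field of reals or the field of complex numbers, with its usual
  absolute value, up to isomorphism.\<close>

class real_or_complex = real_normed_field +
  assumes real_or_complex:
    "\<exists>f :: 'a \<Rightarrow> complex. (range f = \<real> \<or> range f = UNIV) \<and>
       (\<forall>x y. f (x + y) = f x + f y) \<and> (\<forall>x y. f (x * y) = f x * f y) \<and>
       (\<forall>x. cmod (f x) = norm x)"

instance real :: real_or_complex
proof
  show "\<exists>f :: real \<Rightarrow> complex. (range f = \<real> \<or> range f = UNIV) \<and>
       (\<forall>x y. f (x + y) = f x + f y) \<and> (\<forall>x y. f (x * y) = f x * f y) \<and>
       (\<forall>x. cmod (f x) = norm x)"
    by (rule exI[of _ complex_of_real]) (auto simp: Reals_def)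
qed

instance complex :: real_or_complex
proof
  show "\<exists>f :: complex \<Rightarrow> complex. (range f = \<real> \<or> range f = UNIV) \<and>
       (\<forall>x y. f (x + y) = f x + f y) \<and> (\<forall>x y. f (x * y) = f x * f y) \<and>
       (\<forall>x. cmod (f x) = norm x)"
    by (rule exI[of _ "\<lambda>x. x"]) auto
qed

text \<open>A Frechet space is a vector space, whose underlying set is a whole type, with an
  increasing separating sequence of seminorms for which it is complete. Seminorms are indexed
  from 0, so \<open>p n\<close> is the seminorm usually written with index \<open>n + 1\<close>.
  A Banach space with norm \<open>nrm\<close> is the case of the constant sequence \<open>\<lambda>_. nrm\<close>.\<close>

locale frechet_space = vector_space scale
  for scale :: "'k::real_or_complex \<Rightarrow> 'a::ab_group_add \<Rightarrow> 'a" +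
  fixes p :: "nat \<Rightarrow> 'a \<Rightarrow> real"
  assumes seminorm_triangle: "p n (x + y) \<le> p n x + p n y"
    and seminorm_scale: "p n (scale c x) = norm c * p n x"
    and seminorm_increasing: "p n x \<le> p (Suc n) x"
    and seminorm_separating: "(\<forall>n. p n x = 0) \<Longrightarrow> x = 0"
    and seminorm_complete:
      "(\<And>n e. e > 0 \<Longrightarrow> \<exists>M. \<forall>i\<ge>M. \<forall>j\<ge>M. p n (u i - u j) < e)
        \<Longrightarrow> \<exists>l. \<forall>n. (\<lambda>i. p n (u i - l)) \<longlonglongrightarrow> 0"

definition seminorm_topology :: "(nat \<Rightarrow> 'a::ab_group_add \<Rightarrow> real) \<Rightarrow> 'a topology" where
  "seminorm_topology p =
     topology (\<lambda>U. \<forall>x\<in>U. \<exists>n. \<exists>r>0. {y. p n (y - x) < r} \<subseteq> U)"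

lemma (in frechet_space) openin_seminorm_topology:
  "openin (seminorm_topology p) U \<longleftrightarrow> (\<forall>x\<in>U. \<exists>n. \<exists>r>0. {y. p n (y - x) < r} \<subseteq> U)"
proof -
  let ?P = "\<lambda>U. \<forall>x\<in>U. \<exists>n. \<exists>r>0. {y. p n (y - x) < r} \<subseteq> U"
  have mono: "p m x \<le> p n x" if "m \<le> n" for m n x
    using lift_Suc_mono_le[of "\<lambda>n. p n x"] that seminorm_increasing by blast
  have inter: "?P (S \<inter> T)" if S: "?P S" and T: "?P T" for S T
  proof
    fix x assume x: "x \<in> S \<inter> T"
    obtain m r where r: "r > 0" "{y. p m (y - x) < r} \<subseteq> S" using S x by blast
    obtain n q where q: "q > 0" "{y. p n (y - x) < q} \<subseteq> T" using T x by blast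
    have "y \<in> S \<inter> T" if "p (max m n) (y - x) < min r q" for y
      using that r(2) q(2) mono[of m "max m n" "y - x"] mono[of n "max m n" "y - x"] by auto
    then show "\<exists>n. \<exists>r>0. {y. p n (y - x) < r} \<subseteq> S \<inter> T"
      using r(1) q(1) by (intro exI[of _ "max m n"] exI[of _ "min r q"]) auto
  qed
  have union: "?P (\<Union>K)" if "\<forall>S\<in>K. ?P S" for K
  proof
    fix x assume "x \<in> \<Union>K"
    then obtain S where S: "S \<in> K" "x \<in> S" by blast
    then obtain n r where "r > 0" "{y. p n (y - x) < r} \<subseteq> S" using \<open>\<forall>S\<in>K. ?P S\<close> by blast
    then show "\<exists>n. \<exists>r>0. {y. p n (y - x) < r} \<subseteq> \<Union>K" using S(1) by blast
  qed
  have "istopology ?P"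
    unfolding istopology_def using inter union by presburger
  then show ?thesis
    unfolding seminorm_topology_def by (simp add: topology_inverse')
qed

definition frechet_dist :: "(nat \<Rightarrow> 'a::ab_group_add \<Rightarrow> real) \<Rightarrow> 'a \<Rightarrow> 'a \<Rightarrow> real" where
  "frechet_dist p x y = (\<Sum>n. (1/2) ^ Suc n * (p n (x - y) / (1 + p n (x - y))))"

text \<open>The metrics used on a Frechet space: the one built from the seminorms or, if the space is
  a Banach space, the one given by a complete norm inducing its topology.\<close>

definition standard_metric ::
  "('k::real_or_complex \<Rightarrow> 'a::ab_group_add \<Rightarrow> 'a) \<Rightarrow> (nat \<Rightarrow> 'a \<Rightarrow> real) \<Rightarrow> ('a \<Rightarrow> 'a \<Rightarrow> real) \<Rightarrow> bool"
  where
  "standard_metric sc p d \<longleftrightarrow>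
     d = frechet_dist p \<or>
     (\<exists>nrm. frechet_space sc (\<lambda>_. nrm) \<and>
            seminorm_topology (\<lambda>_. nrm) = seminorm_topology p \<and>
            d = (\<lambda>x y. nrm (x - y)))"

definition max_dist :: "('a \<Rightarrow> 'a \<Rightarrow> real) \<Rightarrow> 'a^'n \<Rightarrow> 'a^'n \<Rightarrow> real" where
  "max_dist d x y = (MAX j. d (x $ j) (y $ j))"

definition prod_scale :: "('k \<Rightarrow> 'a \<Rightarrow> 'a) \<Rightarrow> 'k \<Rightarrow> 'a^'n \<Rightarrow> 'a^'n" where
  "prod_scale sc c x = (\<chi> j. sc c (x $ j))"

definition mdom :: "('a \<Rightarrow> 'b set) \<Rightarrow> 'a set" where
  "mdom A = {x. A x \<noteq> {}}"

definition MLO :: "('k::field \<Rightarrow> 'a::ab_group_add \<Rightarrow> 'a) \<Rightarrow> ('k \<Rightarrow> 'b::ab_group_add \<Rightarrow> 'b)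
    \<Rightarrow> ('a \<Rightarrow> 'b set) \<Rightarrow> bool" where
  "MLO scaleX scaleZ A \<longleftrightarrow>
     module.subspace scaleX (mdom A) \<and>
     (\<forall>x\<in>mdom A. \<forall>y\<in>mdom A. {u + v |u v. u \<in> A x \<and> v \<in> A y} \<subseteq> A (x + y)) \<and>
     (\<forall>c. \<forall>x\<in>mdom A. scaleZ c ` A x \<subseteq> A (scaleX c x))"

definition prod_MLO :: "('n \<Rightarrow> 'a \<Rightarrow> 'b set) \<Rightarrow> 'a \<Rightarrow> ('b^'n) set" where
  "prod_MLO A x = {v. \<forall>j. v $ j \<in> A j x}"

lemma mdom_prod_MLO: "mdom (prod_MLO A) = (\<Inter>j. mdom (A j))"
proof -
  have "(\<exists>v. \<forall>j. v $ j \<in> A j x) \<longleftrightarrow> (\<forall>j. \<exists>u. u \<in> A j x)" for x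
  proof
    assume "\<forall>j. \<exists>u. u \<in> A j x"
    then obtain f where "\<forall>j. f j \<in> A j x" by metis
    then show "\<exists>v. \<forall>j. v $ j \<in> A j x" by (intro exI[of _ "\<chi> j. f j"]) simp
  qed blast
  then show ?thesis unfolding mdom_def prod_MLO_def by auto
qed

lemma MLO_prod_MLO:
  assumes "module scaleX" and "\<And>j. MLO scaleX scaleY (A j)"
  shows "MLO scaleX (prod_scale scaleY) (prod_MLO A)"
proof -
  interpret module scaleX by fact
  have "subspace (mdom (prod_MLO A))"
    using assms(2) unfolding mdom_prod_MLO MLO_def by (intro subspace_Inter) auto
  moreover have "u + v \<in> prod_MLO A (x + y)"
    if uv: "u \<in> prod_MLO A x" "v \<in> prod_MLO A y" for u v x y
  proof -
    have "u $ j + v $ j \<in> A j (x + y)" for j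
    proof -
      have "u $ j \<in> A j x" "v $ j \<in> A j y" using uv by (simp_all add: prod_MLO_def)
      moreover from this have "x \<in> mdom (A j)" "y \<in> mdom (A j)" by (auto simp: mdom_def)
      ultimately show ?thesis using assms(2)[of j] unfolding MLO_def by blast
    qed
    then show ?thesis by (simp add: prod_MLO_def)
  qed
  moreover have "prod_scale scaleY c u \<in> prod_MLO A (scaleX c x)"
    if u: "u \<in> prod_MLO A x" for u c x
  proof -
    have "scaleY c (u $ j) \<in> A j (scaleX c x)" for j
    proof -
      have "u $ j \<in> A j x" using u by (simp add: prod_MLO_def)
      moreover from this have "x \<in> mdom (A j)" by (auto simp: mdom_def)
      ultimately show ?thesis using assms(2)[of j] unfolding MLO_def by blast
    qed
    then show ?thesis by (simp add: prod_MLO_def prod_scale_def)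
  qed
  ultimately show ?thesis unfolding MLO_def by blast
qed

text \<open>The natural numbers indexing sequences start at 1: index 0 is never counted by the density
  below, and the operators with index 0 play no role.\<close>

definition upper_density :: "nat set \<Rightarrow> ereal" where
  "upper_density D = limsup (\<lambda>n. ereal (real (card (D \<inter> {1..n})) / real n))"

definition distributionally_chaotic ::
  "'a set \<Rightarrow> ('z \<Rightarrow> 'z \<Rightarrow> real) \<Rightarrow> (nat \<Rightarrow> 'a \<Rightarrow> 'z set) \<Rightarrow> bool" where
  "distributionally_chaotic Xt d B \<longleftrightarrow>
     (\<exists>S \<sigma>. uncountable S \<and> S \<subseteq> (\<Inter>k\<in>{1..}. mdom (B k)) \<inter> Xt \<and> \<sigma> > 0 \<and>
       (\<forall>\<epsilon>>0. \<forall>x\<in>S. \<forall>y\<in>S. x \<noteq> y \<longrightarrow>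
         (\<exists>u v. (\<forall>k\<ge>1. u k \<in> B k x \<and> v k \<in> B k y) \<and>
            upper_density {k. d (u k) (v k) \<ge> \<sigma>} = 1 \<and>
            upper_density {k. d (u k) (v k) < \<epsilon>} = 1)))"

definition disjoint_distributionally_chaotic_9 ::
  "'a set \<Rightarrow> ('b \<Rightarrow> 'b \<Rightarrow> real) \<Rightarrow> ('n::finite \<Rightarrow> nat \<Rightarrow> 'a \<Rightarrow> 'b set) \<Rightarrow> bool" where
  "disjoint_distributionally_chaotic_9 Xt d A \<longleftrightarrow>
     (\<exists>S \<sigma>. uncountable S \<and> S \<subseteq> (\<Inter>j. \<Inter>k\<in>{1..}. mdom (A j k)) \<inter> Xt \<and> \<sigma> > 0 \<and>
       (\<forall>\<epsilon>>0. \<forall>x\<in>S. \<forall>y\<in>S. x \<noteq> y \<longrightarrow>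
         (\<exists>u v. (\<forall>j. \<forall>k\<ge>1. u j k \<in> A j k x \<and> v j k \<in> A j k y) \<and>
            upper_density (\<Union>j. {k. d (u j k) (v j k) \<ge> \<sigma>}) = 1 \<and>
            upper_density (\<Inter>j. {k. d (u j k) (v j k) < \<epsilon>}) = 1)))"

end

theory Submission
  imports Defs
begin

text \<open>
  For finitely many indices \<open>j\<close>, the maximum of the distances \<open>d (u\<^sub>j) (v\<^sub>j)\<close> reaches
  \<open>\<sigma>\<close> exactly when some of them does, and it stays below \<open>\<epsilon>\<close> exactly when all of them do.
  So the union and the intersection of index sets over \<open>j\<close> in the definition of disjoint
  distributional chaos are the two index sets in the definition of distributional chaos
  for the maximum metric: the densities required are densities of the same sets.
  Moreover, a vector selected from the product operator at \<open>x\<close> is the same thing as a family of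
  selections, one from each component operator, and the domain of the product operator is the
  intersection of the component domains.  Hence the same scrambled set \<open>S\<close> and the same
  \<open>\<sigma>\<close> serve on both sides.
\<close>

lemma max_dist_ge_iff:
  fixes u v :: "'b^'n::finite"
  shows "max_dist d u v \<ge> \<sigma> \<longleftrightarrow> (\<exists>j. d (u $ j) (v $ j) \<ge> \<sigma>)"
  unfolding max_dist_def by (subst Max_ge_iff) auto

lemma max_dist_less_iff:
  fixes u v :: "'b^'n::finite"
  shows "max_dist d u v < \<epsilon> \<longleftrightarrow> (\<forall>j. d (u $ j) (v $ j) < \<epsilon>)"
  unfolding max_dist_def by (subst Max_less_iff) auto

text \<open>For a fixed pair of points, one direction takes components of the selected vectors and the
  other assembles selected components into vectors. The properties \<open>P\<close> and \<open>Q\<close> of index sets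
  stand for the two density requirements, which carry over because the index sets themselves
  agree.\<close>

lemma scrambling_selections_prod_iff:
  fixes A :: "'n::finite \<Rightarrow> nat \<Rightarrow> 'a \<Rightarrow> 'b set"
  shows "(\<exists>u v. (\<forall>j. \<forall>k\<ge>1. u j k \<in> A j k x \<and> v j k \<in> A j k y) \<and>
            P (\<Union>j. {k. d (u j k) (v j k) \<ge> \<sigma>}) \<and>
            Q (\<Inter>j. {k. d (u j k) (v j k) < \<epsilon>})) \<longleftrightarrow>
         (\<exists>u v. (\<forall>k\<ge>1. u k \<in> prod_MLO (\<lambda>j. A j k) x \<and> v k \<in> prod_MLO (\<lambda>j. A j k) y) \<and>
            P {k. max_dist d (u k) (v k) \<ge> \<sigma>} \<and>
            Q {k. max_dist d (u k) (v k) < \<epsilon>})"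
    (is "?families \<longleftrightarrow> ?vectors")
proof
  assume ?families
  then obtain u v where
    sel: "\<forall>j. \<forall>k\<ge>1. u j k \<in> A j k x \<and> v j k \<in> A j k y" and
    P: "P (\<Union>j. {k. d (u j k) (v j k) \<ge> \<sigma>})" and
    Q: "Q (\<Inter>j. {k. d (u j k) (v j k) < \<epsilon>})"
    by blast
  define u' v' where "u' = (\<lambda>k. \<chi> j. u j k)" and "v' = (\<lambda>k. \<chi> j. v j k)"
  have "{k. max_dist d (u' k) (v' k) \<ge> \<sigma>} = (\<Union>j. {k. d (u j k) (v j k) \<ge> \<sigma>})"
    by (auto simp: max_dist_ge_iff u'_def v'_def)
  moreover have "{k. max_dist d (u' k) (v' k) < \<epsilon>} = (\<Inter>j. {k. d (u j k) (v j k) < \<epsilon>})"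
    by (auto simp: max_dist_less_iff u'_def v'_def)
  moreover have "\<forall>k\<ge>1. u' k \<in> prod_MLO (\<lambda>j. A j k) x \<and> v' k \<in> prod_MLO (\<lambda>j. A j k) y"
    using sel by (simp add: prod_MLO_def u'_def v'_def)
  ultimately show ?vectors
    using P Q by (intro exI[of _ u'] exI[of _ v']) simp
next
  assume ?vectors
  then obtain u v where
    sel: "\<forall>k\<ge>1. u k \<in> prod_MLO (\<lambda>j. A j k) x \<and> v k \<in> prod_MLO (\<lambda>j. A j k) y" and
    P: "P {k. max_dist d (u k) (v k) \<ge> \<sigma>}" and
    Q: "Q {k. max_dist d (u k) (v k) < \<epsilon>}"
    by blast
  have "(\<Union>j. {k. d (u k $ j) (v k $ j) \<ge> \<sigma>}) = {k. max_dist d (u k) (v k) \<ge> \<sigma>}"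
    by (auto simp: max_dist_ge_iff)
  moreover have "(\<Inter>j. {k. d (u k $ j) (v k $ j) < \<epsilon>}) = {k. max_dist d (u k) (v k) < \<epsilon>}"
    by (auto simp: max_dist_less_iff)
  moreover have "\<forall>j. \<forall>k\<ge>1. u k $ j \<in> A j k x \<and> v k $ j \<in> A j k y"
    using sel by (simp add: prod_MLO_def)
  ultimately show ?families
    using P Q by (intro exI[of _ "\<lambda>j k. u k $ j"] exI[of _ "\<lambda>j k. v k $ j"]) simp
qed

theorem proposition3p5:
  fixes scaleX :: "'k::real_or_complex \<Rightarrow> 'x::ab_group_add \<Rightarrow> 'x"
    and scaleY :: "'k \<Rightarrow> 'y::ab_group_add \<Rightarrow> 'y"
    and pX :: "nat \<Rightarrow> 'x \<Rightarrow> real"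
    and pY :: "nat \<Rightarrow> 'y \<Rightarrow> real"
    and dY :: "'y \<Rightarrow> 'y \<Rightarrow> real"
    and Xt :: "'x set"
    and A :: "'n::finite \<Rightarrow> nat \<Rightarrow> 'x \<Rightarrow> 'y set"
  assumes "frechet_space scaleX pX" and "\<exists>x::'x. x \<noteq> 0"
    and "frechet_space scaleY pY" and "\<exists>y::'y. y \<noteq> 0"
    and "standard_metric scaleY pY dY"
    and "CARD('n) \<ge> 2"
    and "module.subspace scaleX Xt" and "closedin (seminorm_topology pX) Xt"
    and "\<And>j k. k \<ge> 1 \<Longrightarrow> MLO scaleX scaleY (A j k)"
  shows "disjoint_distributionally_chaotic_9 Xt dY A \<longleftrightarrow>
         distributionally_chaotic Xt (max_dist dY) (\<lambda>k. prod_MLO (\<lambda>j. A j k))"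
proof -
  have dom: "(\<Inter>j. \<Inter>k\<in>{1..}. mdom (A j k)) = (\<Inter>k\<in>{1..}. mdom (prod_MLO (\<lambda>j. A j k)))"
    unfolding mdom_prod_MLO by blast
  show ?thesis
    unfolding disjoint_distributionally_chaotic_9_def distributionally_chaotic_def dom
    by (simp only: scrambling_selections_prod_iff[where P = "\<lambda>D. upper_density D = 1"
          and Q = "\<lambda>D. upper_density D = 1"])
qed

end
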